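(* For $x\in\mathbb Z^N_\geqslant$ let $\varphi(x)$ be the number of lattice paths in $\mathbb Z^N$ from the origin to $x$ using only steps in $\{e^1,\dots,e^N\}$. Then for every $\lambda\in\mathbb Z^n$ the associated vector partition function $P_A(\lambda;\varphi)$ equals the number of generalized lattice paths from the origin to $\lambda$ with steps in $\Delta=\{\alpha^1,\dots,\alpha^N\}$, and the generating function $F(z)=\sum_{\lambda\in K\cap\mathbb Z^n}P_A(\lambda;\varphi)z^\lambda$ has the form $$F(z)=\frac{1}{1-z^{\alpha^1}-z^{\alpha^2}-\cdots-z^{\alpha^N}}.$$
   Context: $\Delta=\{\alpha^1,\dots,\alpha^N\}\subset\mathbb Z^n$ is a finite set of $N$ (distinct) column vectors, $A=[\alpha^1,\dots,\alpha^N]$ is the $n\times N$ matrix with these columns, and $K=\{x_1\alpha^1+\cdots+x_N\alpha^N: x\in\mathbb R^N,\ x_j\ge0\}$. It is assumed that $K$ is pointed, in the sense that $\alpha^1,\dots,\alpha^N$ all lie in an open half-space $\{v\in\mathbb R^n:\ell(v)>0\}$ for some linear functional $\ell$. $\mathbb Z^N_\geqslant$ is the set of integer vectors with non-negative coordinates, and $e^1,\dots,e^N$ is the standard basis of $\mathbb Z^N$. For $\psi:\mathbb Z^N_\geqslant\to\mathbb C$, the vector partition function associated with $\psi$ is $P_A(\lambda;\psi)=\sum_{x\in\mathbb Z^N_\geqslant,\ Ax=\lambda}\psi(x)$ for $\lambda\in\mathbb Z^n$ (a finite sum). A (generalized) lattice path from the origin to a point with steps in a finite set $S$ is a finite sequence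 (possibly empty) of elements of $S$ whose sum is that point; the number of paths is the number of such sequences. The formula for $F$ is an identity in the ring of formal Laurent series in $z=(z_1,\dots,z_n)$ supported in $K\cap\mathbb Z^n$ (multiplication is well defined since $K$ is pointed), meaning that $F(z)\,(1-z^{\alpha^1}-\cdots-z^{\alpha^N})=1$. *)

theory Defs
  imports "HOL-Analysis.Analysis"
begin

text \<open>
  The vectors \<open>\<alpha>\<^sup>1, \<dots>, \<alpha>\<^sup>N\<close> are the columns of \<open>A :: int^'N^'n\<close>, so \<open>n = CARD('n)\<close> and
  \<open>N = CARD('N)\<close>.
\<close>

definition real_vec :: "int^'n \<Rightarrow> real^'n" where
  "real_vec v = (\<chi> i. real_of_int (v $ i))"

definition col_cone :: "int^'N^'n \<Rightarrow> (real^'n) set" where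
  "col_cone A = {\<Sum>j\<in>UNIV. x $ j *\<^sub>R real_vec (column j A) | x :: real^'N. \<forall>j. 0 \<le> x $ j}"

definition pointed :: "int^'N^'n \<Rightarrow> bool" where
  "pointed A \<longleftrightarrow>
    (\<exists>l :: real^'n \<Rightarrow> real. linear l \<and> (\<forall>j. 0 < l (real_vec (column j A))))"

definition cone_lattice :: "int^'N^'n \<Rightarrow> (int^'n) set" where
  "cone_lattice A = {v. real_vec v \<in> col_cone A}"

definition nonneg_vecs :: "(int^'N) set" where
  "nonneg_vecs = {x. \<forall>j. 0 \<le> x $ j}"

text \<open>
  The index set is finite for pointed \<open>A\<close> (lemma \<open>finite_fibre\<close> below). Only the values of
  \<open>\<psi>\<close> on \<open>nonneg_vecs\<close> matter.
\<close>

definition vector_partition ::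
    "int^'N^'n \<Rightarrow> (int^'N \<Rightarrow> complex) \<Rightarrow> int^'n \<Rightarrow> complex" where
  "vector_partition A \<psi> v = (\<Sum>x | x \<in> nonneg_vecs \<and> A *v x = v. \<psi> x)"

definition lattice_paths :: "'a::comm_monoid_add set \<Rightarrow> 'a \<Rightarrow> 'a list set" where
  "lattice_paths S v = {p. set p \<subseteq> S \<and> sum_list p = v}"

definition num_paths :: "'a::comm_monoid_add set \<Rightarrow> 'a \<Rightarrow> nat" where
  "num_paths S v = card (lattice_paths S v)"

definition std_basis :: "(int^'N) set" where
  "std_basis = range (\<lambda>j. axis j 1)"

definition path_count :: "int^'N \<Rightarrow> nat" where
  "path_count x = num_paths std_basis x"

text \<open>
  A formal Laurent series supported in \<open>S\<close> is given by its coefficient function, which vanishes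
  outside \<open>S\<close>. For \<open>S = cone_lattice A\<close> with \<open>A\<close> pointed, the sum in the product has finitely
  many terms (lemma \<open>finite_convolution\<close> below).
\<close>

definition laurent_on :: "(int^'n) set \<Rightarrow> (int^'n \<Rightarrow> complex) set" where
  "laurent_on S = {f. \<forall>v. v \<notin> S \<longrightarrow> f v = 0}"

definition laurent_monom :: "int^'n \<Rightarrow> int^'n \<Rightarrow> complex" where
  "laurent_monom a = (\<lambda>v. if v = a then 1 else 0)"

definition laurent_mult ::
    "(int^'n) set \<Rightarrow> (int^'n \<Rightarrow> complex) \<Rightarrow> (int^'n \<Rightarrow> complex) \<Rightarrow> int^'n \<Rightarrow> complex" where
  "laurent_mult S f g = (\<lambda>v. \<Sum>(u, w) | u \<in> S \<and> w \<in> S \<and> u + w = v. f u * g w)"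

definition gen_fun :: "int^'N^'n \<Rightarrow> int^'n \<Rightarrow> complex" where
  "gen_fun A = (\<lambda>v. if v \<in> cone_lattice A
     then vector_partition A (\<lambda>x. of_nat (path_count x)) v else 0)"

definition denominator :: "int^'N^'n \<Rightarrow> int^'n \<Rightarrow> complex" where
  "denominator A = (\<lambda>v. laurent_monom 0 v - (\<Sum>j\<in>UNIV. laurent_monom (column j A) v))"

text \<open>
  The remaining lemmas show that the sums, cardinalities and products above are the intended
  finite ones.
\<close>

lemma real_vec_add: "real_vec (u + v) = real_vec u + real_vec v"
  by (simp add: real_vec_def vec_eq_iff)

lemma real_vec_0 [simp]: "real_vec 0 = 0"
  by (simp add: real_vec_def vec_eq_iff)

lemma real_vec_mult:
  "real_vec (A *v x) = (\<Sum>j\<in>UNIV. real_of_int (x $ j) *\<^sub>R real_vec (column j A))"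
  by (simp add: real_vec_def vec_eq_iff matrix_vector_mult_def column_def mult.commute)

lemma finite_int_box:
  fixes b :: "'n::finite \<Rightarrow> int"
  shows "finite {x :: int^'n. \<forall>j. \<bar>x $ j\<bar> \<le> b j}"
proof (rule finite_subset)
  show "{x :: int^'n. \<forall>j. \<bar>x $ j\<bar> \<le> b j} \<subseteq> vec_lambda ` (PiE UNIV (\<lambda>j. {- b j..b j}))"
  proof
    fix x :: "int^'n" assume "x \<in> {x. \<forall>j. \<bar>x $ j\<bar> \<le> b j}"
    then have "vec_nth x \<in> PiE UNIV (\<lambda>j. {- b j..b j})"
      by (auto simp: abs_le_iff minus_le_iff)
    then show "x \<in> vec_lambda ` (PiE UNIV (\<lambda>j. {- b j..b j}))"
      by (metis image_eqI vec_nth_inverse)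
  qed
qed (simp add: finite_PiE)

lemma finite_fibre:
  fixes A :: "int^'N^'n"
  assumes "pointed A"
  shows "finite {x. x \<in> nonneg_vecs \<and> A *v x = v}"
proof -
  obtain l :: "real^'n \<Rightarrow> real" where l: "linear l" "\<And>j. 0 < l (real_vec (column j A))"
    using assms unfolding pointed_def by blast
  define c where "c j = l (real_vec (column j A))" for j
  show ?thesis
  proof (rule finite_subset [OF _ finite_int_box])
    show "{x. x \<in> nonneg_vecs \<and> A *v x = v} \<subseteq>
      {x. \<forall>j. \<bar>x $ j\<bar> \<le> \<lfloor>l (real_vec v) / c j\<rfloor>}"
    proof clarify
      fix x j assume x: "x \<in> nonneg_vecs" and "v = A *v x"
      then have "l (real_vec (A *v x)) = (\<Sum>j\<in>UNIV. real_of_int (x $ j) * c j)"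
        by (simp add: real_vec_mult linear_sum [OF l(1)] linear_scale [OF l(1)] c_def)
      moreover have "real_of_int (x $ j) * c j \<le> (\<Sum>j\<in>UNIV. real_of_int (x $ j) * c j)"
        by (rule member_le_sum) (use x l(2) in \<open>auto simp: nonneg_vecs_def c_def less_imp_le\<close>)
      ultimately show "\<bar>x $ j\<bar> \<le> \<lfloor>l (real_vec (A *v x)) / c j\<rfloor>"
        using x l(2)[of j] by (auto simp: nonneg_vecs_def le_floor_iff c_def pos_le_divide_eq)
    qed
  qed
qed

lemma finite_lattice_paths:
  fixes S :: "'a::comm_monoid_add set" and f :: "'a \<Rightarrow> real"
  assumes "finite S" and f0: "f 0 = 0" and fadd: "\<And>x y. f (x + y) = f x + f y"
    and pos: "\<And>s. s \<in> S \<Longrightarrow> 0 < f s"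
  shows "finite (lattice_paths S v)"
proof -
  obtain d where d: "0 < d" "\<And>s. s \<in> S \<Longrightarrow> d \<le> f s"
  proof (cases "S = {}")
    case False
    show ?thesis
      by (rule that [of "Min (f ` S)"]) (use assms False in auto)
  qed (use that [of 1] in auto)
  have len: "real (length p) * d \<le> f (sum_list p)" if "set p \<subseteq> S" for p
    using that
  proof (induction p)
    case (Cons a p)
    then show ?case using d(2)[of a] by (auto simp: fadd algebra_simps)
  qed (simp add: f0)
  show ?thesis
  proof (rule finite_subset [OF _ finite_lists_length_le [OF assms(1), of "nat \<lfloor>f v / d\<rfloor>"]])
    show "lattice_paths S v \<subseteq> {p. set p \<subseteq> S \<and> length p \<le> nat \<lfloor>f v / d\<rfloor>}"
    proof
      fix p assume "p \<in> lattice_paths S v"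
      then have p: "set p \<subseteq> S" "sum_list p = v" by (auto simp: lattice_paths_def)
      then have "real (length p) \<le> f v / d"
        using len [of p] d(1) by (simp add: pos_le_divide_eq)
      then show "p \<in> {p. set p \<subseteq> S \<and> length p \<le> nat \<lfloor>f v / d\<rfloor>}"
        using p(1) by (simp add: le_nat_floor)
    qed
  qed
qed

lemma finite_column_paths:
  fixes A :: "int^'N^'n"
  assumes "pointed A"
  shows "finite (lattice_paths (columns A) v)"
proof -
  obtain l :: "real^'n \<Rightarrow> real" where l: "linear l" "\<And>j. 0 < l (real_vec (column j A))"
    using assms unfolding pointed_def by blast
  show ?thesis
    by (rule finite_lattice_paths [where f = "\<lambda>v. l (real_vec v)"])
      (auto simp: columns_def full_SetCompr_eq real_vec_add linear_add [OF l(1)] linear_0 [OF l(1)] l(2))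
qed

lemma finite_std_paths: "finite (lattice_paths std_basis (x :: int^'N))"
  by (rule finite_lattice_paths [where f = "\<lambda>v. real_of_int (\<Sum>j\<in>UNIV. v $ j)"])
    (auto simp: std_basis_def sum.distrib axis_def simp del: of_int_sum)

lemma finite_convolution:
  fixes A :: "int^'N^'n"
  assumes "pointed A"
  shows "finite {(u, w). u \<in> cone_lattice A \<and> w \<in> cone_lattice A \<and> u + w = v}"
proof -
  obtain l :: "real^'n \<Rightarrow> real" where l: "linear l" "\<And>j. 0 < l (real_vec (column j A))"
    using assms unfolding pointed_def by blast
  define c where "c j = l (real_vec (column j A))" for j
  define B where "B i = (\<Sum>j\<in>UNIV. l (real_vec v) / c j * \<bar>real_of_int (column j A $ i)\<bar>)" for i
  have cpos: "0 < c j" for j using l(2) by (simp add: c_def)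
  have l_sum: "l (\<Sum>j\<in>UNIV. x $ j *\<^sub>R real_vec (column j A)) = (\<Sum>j\<in>UNIV. x $ j * c j)"
    for x :: "real^'N"
    by (simp add: linear_sum [OF l(1)] linear_scale [OF l(1)] c_def)
  have nonneg: "0 \<le> l (real_vec w)" if "w \<in> cone_lattice A" for w
    using that cpos
    by (auto simp: cone_lattice_def col_cone_def l_sum less_imp_le intro!: sum_nonneg)
  have bound: "\<bar>u $ i\<bar> \<le> \<lfloor>B i\<rfloor>"
    if u: "u \<in> cone_lattice A" and le: "l (real_vec u) \<le> l (real_vec v)" for u i
  proof -
    obtain x :: "real^'N" where x: "\<And>j. 0 \<le> x $ j"
      "real_vec u = (\<Sum>j\<in>UNIV. x $ j *\<^sub>R real_vec (column j A))"
      using u by (auto simp: cone_lattice_def col_cone_def)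
    have xle: "x $ j \<le> l (real_vec v) / c j" for j
    proof -
      have "x $ j * c j \<le> (\<Sum>j\<in>UNIV. x $ j * c j)"
        by (rule member_le_sum) (use x(1) cpos in \<open>auto simp: less_imp_le\<close>)
      then show ?thesis using le cpos[of j] by (simp add: x(2) l_sum pos_le_divide_eq)
    qed
    have "real_of_int (u $ i) = real_vec u $ i" by (simp add: real_vec_def)
    also have "\<dots> = (\<Sum>j\<in>UNIV. x $ j * real_of_int (column j A $ i))"
      by (simp add: x(2)) (simp add: real_vec_def)
    finally have "\<bar>real_of_int (u $ i)\<bar> \<le> (\<Sum>j\<in>UNIV. \<bar>x $ j * real_of_int (column j A $ i)\<bar>)"
      by simp
    also have "\<dots> \<le> B i"
      unfolding B_def
      by (rule sum_mono) (use x(1) xle in \<open>auto simp: abs_mult simp del: times_divide_eq_left intro!: mult_right_mono\<close>)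
    finally show ?thesis by (simp add: le_floor_iff)
  qed
  have "{(u, w). u \<in> cone_lattice A \<and> w \<in> cone_lattice A \<and> u + w = v} \<subseteq>
      (\<lambda>u. (u, v - u)) ` {u. \<forall>i. \<bar>u $ i\<bar> \<le> \<lfloor>B i\<rfloor>}"
  proof
    fix z assume "z \<in> {(u, w). u \<in> cone_lattice A \<and> w \<in> cone_lattice A \<and> u + w = v}"
    then obtain u w where z: "z = (u, w)" "u \<in> cone_lattice A" "w \<in> cone_lattice A" "v = u + w"
      by auto
    then have "l (real_vec u) \<le> l (real_vec v)"
      using nonneg [of w] by (simp add: real_vec_add linear_add [OF l(1)])
    then have "u \<in> {u. \<forall>i. \<bar>u $ i\<bar> \<le> \<lfloor>B i\<rfloor>}" using bound [OF z(2)] by blast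
    moreover have "z = (u, v - u)" using z by simp
    ultimately show "z \<in> (\<lambda>u. (u, v - u)) ` {u. \<forall>i. \<bar>u $ i\<bar> \<le> \<lfloor>B i\<rfloor>}"
      by blast
  qed
  then show ?thesis by (rule finite_subset) (simp add: finite_int_box)
qed

lemma zero_in_cone_lattice: "0 \<in> cone_lattice A"
  by (auto simp: cone_lattice_def col_cone_def intro!: exI [of _ 0])

lemma column_in_cone_lattice: "column j A \<in> cone_lattice A"
proof -
  have "(\<Sum>k\<in>UNIV. (axis j 1 :: real^'b) $ k *\<^sub>R real_vec (column k A)) = real_vec (column j A)"
    by (subst sum.remove [of _ j]) (auto simp: axis_def)
  then show ?thesis
    unfolding cone_lattice_def col_cone_def
    by (auto intro!: exI [of _ "axis j 1"] simp: axis_def)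
qed

lemma gen_fun_in_laurent: "gen_fun A \<in> laurent_on (cone_lattice A)"
  by (simp add: gen_fun_def laurent_on_def)

lemma denominator_in_laurent: "denominator A \<in> laurent_on (cone_lattice A)"
  using zero_in_cone_lattice [of A] column_in_cone_lattice [of _ A]
  by (auto simp: denominator_def laurent_on_def laurent_monom_def intro!: sum.neutral)

end

theory Submission
  imports Defs
begin

text \<open>
  The linear map \<open>A\<close> sends \<open>e\<^sup>j\<close> to \<open>\<alpha>\<^sup>j\<close>, and since the \<open>\<alpha>\<^sup>j\<close> are distinct, applying it step by
  step is a bijection from the paths with steps \<open>e\<^sup>j\<close> ending in the fibre of \<open>A\<close> over \<open>\<lambda>\<close> onto the
  paths with steps \<open>\<alpha>\<^sup>j\<close> ending at \<open>\<lambda>\<close>. Splitting off the first step of a path gives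
  \<open>p(\<lambda>) = [\<lambda> = 0] + \<Sum>\<^sub>j p(\<lambda> - \<alpha>\<^sup>j)\<close> for the number \<open>p(\<lambda>)\<close> of the latter, which is the identity
  \<open>F(z) (1 - \<Sum>\<^sub>j z^\<alpha>\<^sup>j) = 1\<close> coefficient by coefficient.
\<close>

lemma lattice_paths_image:
  assumes "f 0 = 0" "\<And>x y. f (x + y) = f x + f y"
  shows "lattice_paths (f ` S) v = map f ` (\<Union>x\<in>{x. f x = v}. lattice_paths S x)"
proof -
  have sum: "sum_list (map f p) = f (sum_list p)" for p
    by (induction p) (simp_all add: assms)
  show ?thesis
  proof (intro equalityI subsetI)
    fix q assume "q \<in> lattice_paths (f ` S) v"
    then have q: "q \<in> lists (f ` S)" "sum_list q = v" by (auto simp: lattice_paths_def)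
    then obtain p where "p \<in> lists S" "q = map f p" by (auto simp: lists_image)
    with q(2) show "q \<in> map f ` (\<Union>x\<in>{x. f x = v}. lattice_paths S x)"
      by (auto simp: lattice_paths_def sum intro!: imageI)
  qed (auto simp: lattice_paths_def sum intro!: imageI)
qed

text \<open>Injectivity on steps makes \<open>map f\<close> injective on paths, and path sets with
  different endpoints are disjoint. \<open>X\<close> may omit fibre points that no path reaches,
  since a full fibre can be infinite.\<close>

lemma num_paths_image:
  assumes "f 0 = 0" "\<And>x y. f (x + y) = f x + f y" and inj: "inj_on f S"
    and fib: "finite X" "\<And>x. x \<in> X \<Longrightarrow> f x = v"
      "\<And>x. f x = v \<Longrightarrow> x \<notin> X \<Longrightarrow> lattice_paths S x = {}"
    and fin: "\<And>x. finite (lattice_paths S x)"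
  shows "num_paths (f ` S) v = (\<Sum>x\<in>X. num_paths S x)"
proof -
  let ?U = "\<Union>x\<in>X. lattice_paths S x"
  have "lattice_paths (f ` S) v = map f ` ?U"
    unfolding lattice_paths_image [OF assms(1,2)]
    by (rule arg_cong [where f = "image (map f)"]) (use fib in blast)
  moreover have "inj_on (map f) ?U"
    by (rule inj_on_subset [OF inj_on_mapI [of f "lists S"]])
      (use inj in \<open>auto simp: lattice_paths_def inj_on_def\<close>)
  ultimately have "num_paths (f ` S) v = card ?U"
    by (simp add: num_paths_def card_image)
  also have "\<dots> = (\<Sum>x\<in>X. num_paths S x)"
    unfolding num_paths_def
    by (rule card_UN_disjoint) (use fib fin in \<open>auto simp: lattice_paths_def\<close>)
  finally show ?thesis .
qed

lemma num_paths_rec: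
  fixes S :: "'a::ab_group_add set"
  assumes "finite S" and fin: "\<And>x. finite (lattice_paths S x)"
  shows "num_paths S v = (if v = 0 then 1 else 0) + (\<Sum>s\<in>S. num_paths S (v - s))"
proof -
  \<comment> \<open>\<open>?E\<close> holds the empty path, the source of the constant term 1;
    \<open>?U\<close> sorts the other paths by first step.\<close>
  let ?E = "if v = 0 then {[]} else {} :: 'a list set" and ?U = "\<Union>s\<in>S. (#) s ` lattice_paths S (v - s)"
  have "lattice_paths S v = ?E \<union> ?U"
  proof (intro equalityI subsetI)
    fix p assume "p \<in> lattice_paths S v"
    then show "p \<in> ?E \<union> ?U"
      by (cases p) (auto simp: lattice_paths_def image_iff eq_neg_iff_add_eq_0 add.commute)
  qed (auto simp: lattice_paths_def split: if_splits)
  then have "num_paths S v = card (?E \<union> ?U)" by (simp add: num_paths_def)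
  also have "\<dots> = card ?E + card ?U"
    by (rule card_Un_disjoint) (use assms in auto)
  also have "card ?U = (\<Sum>s\<in>S. card ((#) s ` lattice_paths S (v - s)))"
    by (rule card_UN_disjoint) (use assms in auto)
  finally show ?thesis by (simp add: card_image num_paths_def)
qed

lemma matrix_vector_mult_axis:
  fixes A :: "'a::semiring_1^'N^'n"
  shows "A *v axis j 1 = column j A"
proof -
  have "(\<Sum>k\<in>UNIV. A $ i $ k * axis j 1 $ k) = A $ i $ j" for i
    by (subst sum.remove [of _ j]) (auto simp: axis_def intro!: sum.neutral)
  then show ?thesis by (simp add: matrix_vector_mult_def column_def vec_eq_iff)
qed

lemma columns_eq_image_std_basis: "columns A = (*v) A ` std_basis"
  by (simp add: columns_def full_SetCompr_eq std_basis_def image_image matrix_vector_mult_axis)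

text \<open>\<open>nonneg_vecs\<close> contains 0 and every step and is closed under
  addition.\<close>

lemma lattice_paths_std_basis_empty:
  assumes "x \<notin> nonneg_vecs"
  shows "lattice_paths std_basis x = {}"
proof -
  have "sum_list p \<in> nonneg_vecs" if "set p \<subseteq> std_basis" for p :: "(int^'N) list"
    using that by (induction p) (auto simp: nonneg_vecs_def std_basis_def axis_def)
  with assms show ?thesis by (auto simp: lattice_paths_def)
qed

lemma vector_partition_path_count:
  fixes A :: "int^'N^'n"
  assumes "inj (\<lambda>j. column j A)" "pointed A"
  shows "vector_partition A (\<lambda>x. of_nat (path_count x)) v = of_nat (num_paths (columns A) v)"
proof -
  have "inj_on ((*v) A) std_basis"
    using assms(1) by (auto simp: inj_on_def std_basis_def matrix_vector_mult_axis)
  then have "num_paths (columns A) v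
      = (\<Sum>x | x \<in> nonneg_vecs \<and> A *v x = v. num_paths std_basis x)"
    unfolding columns_eq_image_std_basis
    by (rule num_paths_image [rotated 2])
      (auto simp: matrix_vector_right_distrib finite_std_paths finite_fibre [OF assms(2)]
        lattice_paths_std_basis_empty)
  then show ?thesis by (simp add: vector_partition_def path_count_def)
qed

text \<open>This makes the cutoff in \<open>gen_fun\<close> harmless: the path recursion can be used
  even where \<open>v - column j A\<close> leaves the cone.\<close>

lemma num_paths_outside_cone:
  fixes A :: "int^'N^'n"
  assumes "v \<notin> cone_lattice A"
  shows "num_paths (columns A) v = 0"
proof -
  have "A *v x \<in> cone_lattice A" if "x \<in> nonneg_vecs" for x
    using that unfolding cone_lattice_def col_cone_def
    by (auto simp: nonneg_vecs_def real_vec_mult intro!: exI [of _ "\<chi> j. real_of_int (x $ j)"])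
  then have "lattice_paths std_basis x = {}" if "A *v x = v" for x
    using that assms lattice_paths_std_basis_empty by blast
  then have "lattice_paths (columns A) v = {}"
    unfolding columns_eq_image_std_basis
    by (subst lattice_paths_image) (auto simp: matrix_vector_right_distrib)
  then show ?thesis by (simp add: num_paths_def)
qed

lemma laurent_mult_monom:
  assumes "a \<in> S" "f \<in> laurent_on S" and fin: "finite {(u, w). u \<in> S \<and> w \<in> S \<and> u + w = v}"
  shows "laurent_mult S f (laurent_monom a) v = f (v - a)"
proof -
  let ?P = "{(u, w). u \<in> S \<and> w \<in> S \<and> u + w = v}"
  have "laurent_mult S f (laurent_monom a) v
      = (\<Sum>z\<in>?P. if z = (v - a, a) then f (v - a) else 0)"
    unfolding laurent_mult_def by (rule sum.cong) (auto simp: laurent_monom_def split: if_splits)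
  \<comment> \<open>If the pair \<open>(v - a, a)\<close> is not in \<open>?P\<close>, then
    \<open>v - a\<close> lies outside \<open>S\<close>, where \<open>f\<close> vanishes.\<close>
  also have "\<dots> = f (v - a)"
    using assms by (auto simp: sum.delta laurent_on_def)
  finally show ?thesis .
qed

text \<open>The product is linear in its second factor, so only monomials matter, and each of them
  shifts \<open>f\<close>.\<close>

lemma laurent_mult_denominator:
  fixes A :: "int^'N^'n"
  assumes "pointed A" "f \<in> laurent_on (cone_lattice A)"
  shows "laurent_mult (cone_lattice A) f (denominator A) v
    = f v - (\<Sum>j\<in>UNIV. f (v - column j A))"
proof -
  let ?S = "cone_lattice A"
  have "laurent_mult ?S f (denominator A) v = laurent_mult ?S f (laurent_monom 0) v
      - (\<Sum>j\<in>UNIV. laurent_mult ?S f (laurent_monom (column j A)) v)"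
    unfolding laurent_mult_def denominator_def
    by (subst sum.swap)
      (simp add: case_prod_unfold right_diff_distrib sum_subtractf sum_distrib_left)
  then show ?thesis
    by (simp add: laurent_mult_monom assms finite_convolution zero_in_cone_lattice
        column_in_cone_lattice)
qed

theorem proposition1p3:
  fixes A :: "int^'N^'n"
  assumes "inj (\<lambda>j. column j A)"
    and "pointed A"
  shows "(\<forall>v. vector_partition A (\<lambda>x. of_nat (path_count x)) v
                = of_nat (num_paths (columns A) v))
       \<and> gen_fun A \<in> laurent_on (cone_lattice A)
       \<and> laurent_mult (cone_lattice A) (gen_fun A) (denominator A) = laurent_monom 0"
proof (intro conjI allI)
  show "laurent_mult (cone_lattice A) (gen_fun A) (denominator A) = laurent_monom 0"
  proof
    fix v
    have gen: "gen_fun A u = of_nat (num_paths (columns A) u)" for u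
      by (simp add: gen_fun_def vector_partition_path_count [OF assms] num_paths_outside_cone)
    have cols: "columns A = range (\<lambda>j. column j A)"
      by (auto simp: columns_def)
    have "num_paths (columns A) v
        = (if v = 0 then 1 else 0) + (\<Sum>s\<in>columns A. num_paths (columns A) (v - s))"
      by (rule num_paths_rec) (simp add: cols, rule finite_column_paths [OF assms(2)])
    \<comment> \<open>Distinctness of the columns lets the sum over the set of steps become a sum
      over indices.\<close>
    also have "(\<Sum>s\<in>columns A. num_paths (columns A) (v - s))
        = (\<Sum>j\<in>UNIV. num_paths (columns A) (v - column j A))"
      by (subst cols) (simp add: sum.reindex [OF assms(1)])
    finally have "gen_fun A v = laurent_monom 0 v + (\<Sum>j\<in>UNIV. gen_fun A (v - column j A))"
      by (simp add: gen laurent_monom_def)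
    then show "laurent_mult (cone_lattice A) (gen_fun A) (denominator A) v = laurent_monom 0 v"
      by (simp add: laurent_mult_denominator [OF assms(2) gen_fun_in_laurent])
  qed
qed (simp_all add: vector_partition_path_count [OF assms] gen_fun_in_laurent)

end
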